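(* Let $k\ge2$ and, for $i\in\{1,\ldots,k\}$, let $f_i:\operatorname{dom}(f_i)\subseteq\mathbb{R}^n\to\mathbb{R}$ be $\mathcal{C}^3$ on the open ball $B(x^0,\overline{\Delta})$, and denote by $L_i$ the Lipschitz constant of $\nabla^2 f_i$ on this ball. Let $\mathcal{X}=\langle x^0,x^1,\ldots,x^m\rangle$ be an ordered set of distinct points with radius $\Delta<\overline{\Delta}$ such that $S=S(\mathcal{X})$ has full rank. Let $\mathbb{U}=\operatorname{span}S$ and $\widehat{S}=S/\Delta$. Then $$\|\nabla^{cc}(f_1\cdots f_k)(\mathcal{X})-\nabla(f_1\cdots f_k)_{\mathbb{U}}(x^0)\|\le\frac{\sqrt{m}}{6}\left(\sum_{i=1}^k L_i\prod_{j\ne i}|f_j(x^0)|\right)\big\|(\widehat{S}^\top)^\dagger\big\|\Delta^2.$$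
   Context: Vectors carry the Euclidean norm and matrices the induced operator norm; $A^\dagger$ is the Moore--Penrose pseudoinverse. For $\mathcal{X}=\langle x^0,x^1,\ldots,x^m\rangle\subset\mathbb{R}^n$ write $x^i=x^0+d^i$ ($m\ge1$); the radius is $\Delta=\max_i\|d^i\|$ and $S(\mathcal{X})=[d^1\ \cdots\ d^m]\in\mathbb{R}^{n\times m}$. Full rank means $\operatorname{rank}S=\min\{m,n\}$; $\operatorname{span}S$ is the column span. The generalized centred simplex gradient of $h$ over $\mathcal{X}$ is $\nabla^c h(\mathcal{X})=(S^\top)^\dagger\delta^c_h(\mathcal{X})$, where $\delta^c_h(\mathcal{X})\in\mathbb{R}^m$ has $i$-th entry $\tfrac12\big(h(x^0+d^i)-h(x^0-d^i)\big)$. The generalized centred simplex calculus gradient of $f_1\cdots f_k$ over $\mathcal{X}$ is defined as $\nabla^{cc}(f_1\cdots f_k)(\mathcal{X})=\sum_{i=1}^k\big(\prod_{j\ne i}f_j(x^0)\big)\nabla^c f_i(\mathcal{X})$. For a function $h$, $h_{\mathbb{U}}(y)=h\big(x^0+\operatorname{Proj}_{\mathbb{U}}(y-x^0)\big)$ with $\operatorname{Proj}_{\mathbb{U}}$ the orthogonal projection onto $\mathbb{U}$. The Lipschitz constants are assumed finite: $\|\nabla^2 f_i(x)-\nabla^2 f_i(y)\|\le L_i\|x-y\|$ on $B(x^0,\overline{\Delta})$. *)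

theory Defs
  imports "HOL-Analysis.Analysis"
begin

text \<open>
  An \<open>n \<times> m\<close> real matrix has type \<open>real^'m^'n\<close>. The \<open>m\<close> points \<open>x\<^sup>1, \<dots>, x\<^sup>m\<close> of the sample set are a
  family \<open>x :: 'm \<Rightarrow> real^'n\<close> with \<open>m = CARD('m)\<close>; the centre \<open>x\<^sup>0\<close> is a separate argument \<open>x0\<close>.
\<close>

section \<open>Matrices and orthogonal projections\<close>

text \<open>The \<^const>\<open>norm\<close> of the matrix type is the Frobenius norm, hence a separate operator norm.\<close>

definition op_norm :: "real^'m^'n \<Rightarrow> real" where
  "op_norm A = onorm (\<lambda>v. A *v v)"

definition moore_penrose :: "real^'m^'n \<Rightarrow> real^'n^'m \<Rightarrow> bool" where
  "moore_penrose A X \<longleftrightarrow>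
     A ** X ** A = A \<and> X ** A ** X = X \<and>
     transpose (A ** X) = A ** X \<and> transpose (X ** A) = X ** A"

definition pinv :: "real^'m^'n \<Rightarrow> real^'n^'m" where
  "pinv A = (THE X. moore_penrose A X)"

definition orth_Proj :: "(real^'n) set \<Rightarrow> real^'n \<Rightarrow> real^'n" where
  "orth_Proj U v = (THE p. p \<in> U \<and> (\<forall>u\<in>U. orthogonal (v - p) u))"

section \<open>Derivatives\<close>

definition gradient :: "(real^'n \<Rightarrow> real) \<Rightarrow> real^'n \<Rightarrow> real^'n" where
  "gradient h y = (THE g. GDERIV h y :> g)"

definition hessian :: "(real^'n \<Rightarrow> real) \<Rightarrow> real^'n \<Rightarrow> real^'n^'n" where
  "hessian h y = jacobian (gradient h) (at y)"

text \<open>Class \<open>C\<^sup>k\<close>, meant for open sets \<open>W\<close>: \<open>gradient h y $ j\<close> is the \<open>j\<close>-th partial derivative.\<close>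

primrec C_k_on :: "nat \<Rightarrow> (real^'n \<Rightarrow> real) \<Rightarrow> (real^'n) set \<Rightarrow> bool" where
  "C_k_on 0 h W \<longleftrightarrow> continuous_on W h"
| "C_k_on (Suc k) h W \<longleftrightarrow>
     (\<forall>y\<in>W. h differentiable (at y)) \<and> (\<forall>j. C_k_on k (\<lambda>y. gradient h y $ j) W)"

section \<open>Simplex gradients\<close>

definition simplex_dir :: "real^'n \<Rightarrow> ('m \<Rightarrow> real^'n) \<Rightarrow> 'm \<Rightarrow> real^'n" where
  "simplex_dir x0 x i = x i - x0"

definition simplex_mat :: "real^'n \<Rightarrow> ('m \<Rightarrow> real^'n) \<Rightarrow> real^'m^'n" where
  "simplex_mat x0 x = (\<chi> r i. simplex_dir x0 x i $ r)"

definition simplex_radius :: "real^'n \<Rightarrow> ('m::finite \<Rightarrow> real^'n) \<Rightarrow> real" where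
  "simplex_radius x0 x = (MAX i. norm (simplex_dir x0 x i))"

definition centred_diff :: "(real^'n \<Rightarrow> real) \<Rightarrow> real^'n \<Rightarrow> ('m \<Rightarrow> real^'n) \<Rightarrow> real^'m" where
  "centred_diff h x0 x =
     (\<chi> i. 1/2 * (h (x0 + simplex_dir x0 x i) - h (x0 - simplex_dir x0 x i)))"

definition centred_simplex_grad ::
    "(real^'n \<Rightarrow> real) \<Rightarrow> real^'n \<Rightarrow> ('m::finite \<Rightarrow> real^'n) \<Rightarrow> real^'n" where
  "centred_simplex_grad h x0 x = pinv (transpose (simplex_mat x0 x)) *v centred_diff h x0 x"

definition centred_calculus_grad ::
    "nat \<Rightarrow> (nat \<Rightarrow> real^'n \<Rightarrow> real) \<Rightarrow> real^'n \<Rightarrow> ('m::finite \<Rightarrow> real^'n) \<Rightarrow> real^'n" where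
  "centred_calculus_grad k f x0 x =
     (\<Sum>i\<in>{1..k}. (\<Prod>j\<in>{1..k} - {i}. f j x0) *\<^sub>R centred_simplex_grad (f i) x0 x)"

definition restrict_along :: "(real^'n) set \<Rightarrow> real^'n \<Rightarrow> (real^'n \<Rightarrow> real) \<Rightarrow> real^'n \<Rightarrow> real" where
  "restrict_along U x0 h = (\<lambda>y. h (x0 + orth_Proj U (y - x0)))"

end

theory Submission
  imports Defs
begin

text \<open>
  Put \<open>A = S\<^sup>T\<close>. The matrix \<open>P = A\<^sup>\<dagger> A\<close> is the orthogonal projection onto \<open>U = span S\<close>
  (\<open>orth_Proj_span_columns\<close>), so by the chain rule restricting a function to \<open>x0 + U\<close> multiplies its
  gradient at \<open>x0\<close> by \<open>P\<close> (\<open>gradient_restrict_along\<close>). Let \<open>c\<^sub>i\<close> be the product of the values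
  \<open>f\<^sub>j(x0)\<close> over \<open>j \<noteq> i\<close>, and \<open>\<delta>\<^sub>i\<close> the vector of central differences of \<open>f\<^sub>i\<close>. The product rule
  expands the gradient of the product with the same weights \<open>c\<^sub>i\<close> that define the calculus gradient,
  so the error is the sum over \<open>i\<close> of \<open>c\<^sub>i A\<^sup>\<dagger> (\<delta>\<^sub>i - A \<nabla>f\<^sub>i(x0))\<close>.

  The entries of the vector in brackets are errors of one-dimensional central differences. The even
  part of \<open>f\<^sub>i\<close> about \<open>x0\<close> cancels, so with a Lipschitz Hessian each entry is at most
  \<open>L\<^sub>i \<parallel>d\<parallel>\<^sup>3 / 6 \<le> L\<^sub>i \<Delta>\<^sup>3 / 6\<close> in absolute value (\<open>centred_difference_error\<close>), and the norm of the
  vector at most \<open>sqrt m\<close> times that. Finally, \<open>A\<^sup>\<dagger>\<close> is the pseudoinverse of the transpose of \<open>S / \<Delta>\<close>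
  divided by \<open>\<Delta>\<close> (\<open>pinv_scaleR\<close>), which turns \<open>\<Delta>\<^sup>3\<close> into \<open>\<Delta>\<^sup>2\<close>.
\<close>

section \<open>The Moore--Penrose pseudoinverse\<close>

lemma generalized_inverse_exists:
  fixes A :: "real^'m^'n"
  shows "\<exists>B. A ** B ** A = A"
proof -
  obtain g where g: "linear g" "\<And>v. v \<in> range ((*v) A) \<Longrightarrow> A *v g v = v"
    using real_vector.linear_exists_right_inverse_on[of "(*v) A" UNIV] by auto
  have "matrix g *v v = g v" for v
    using g(1) by simp
  then have "A ** matrix g ** A = A"
    using g(2) by (simp add: matrix_eq flip: matrix_vector_mul_assoc)
  then show ?thesis ..
qed

lemma matrix_diff_ldistrib: "A ** (B - C) = A ** B - A ** C" for A :: "real^'m^'n"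
  by (simp add: matrix_matrix_mult_def vec_eq_iff sum_subtractf right_diff_distrib)

lemma gram_matrix_eq_0_iff:
  fixes D :: "real^'m^'n"
  shows "transpose D ** D = 0 \<longleftrightarrow> D = 0"
proof
  assume "transpose D ** D = 0"
  then have "inner (column i D) (column i D) = 0" for i
    unfolding matrix_mult_transpose_dot_column by (simp add: vec_eq_iff)
  then show "D = 0"
    by (simp add: vec_eq_iff column_def)
qed simp

text \<open>
  A solution \<open>G\<close> of the normal equations: \<open>A G\<close> is the orthogonal projection onto the range of \<open>A\<close>.
  A generalized inverse \<open>B\<close> of the Gram matrix gives \<open>G = B A\<^sup>T\<close>.
\<close>

lemma range_projection_exists:
  fixes A :: "real^'m^'n"
  shows "\<exists>G. A ** G ** A = A \<and> transpose (A ** G) = A ** G"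
proof -
  obtain B where B: "(transpose A ** A) ** B ** (transpose A ** A) = transpose A ** A"
    using generalized_inverse_exists by blast
  define P where "P = A ** B ** transpose A"
  have "transpose A ** (P ** A - A) = 0"
    using B by (simp add: P_def matrix_diff_ldistrib matrix_mul_assoc)
  moreover have "P ** A - A = A ** (B ** transpose A ** A - mat 1)"
    by (simp add: P_def matrix_diff_ldistrib matrix_mul_assoc)
  ultimately have "transpose (P ** A - A) ** (P ** A - A) = 0"
    by (metis matrix_transpose_mul matrix_mul_assoc times0_right)
  then have PA: "P ** A = A"
    by (simp add: gram_matrix_eq_0_iff)
  \<comment> \<open>\<open>P = P P\<^sup>T\<close>, because \<open>A\<^sup>T P\<^sup>T = A\<^sup>T\<close>\<close>
  have "P ** transpose P = A ** B ** (transpose A ** transpose P)"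
    by (simp add: P_def matrix_mul_assoc)
  also have "\<dots> = P"
    by (metis P_def PA matrix_transpose_mul)
  finally have "transpose P = P"
    by (metis matrix_transpose_mul transpose_transpose)
  with PA show ?thesis
    unfolding P_def by (metis matrix_mul_assoc)
qed

lemma moore_penrose_unique:
  assumes X: "moore_penrose A X" and Y: "moore_penrose A Y"
  shows "X = Y"
proof -
  have "A ** X = transpose (A ** Y ** A ** X)"
    using X Y by (simp add: moore_penrose_def)
  also have "\<dots> = transpose (A ** X) ** transpose (A ** Y)"
    by (metis matrix_transpose_mul matrix_mul_assoc)
  also have "\<dots> = A ** Y"
    using X Y by (simp add: moore_penrose_def matrix_mul_assoc)
  finally have AX: "A ** X = A ** Y" .
  have "X ** A = transpose (X ** (A ** Y ** A))"
    using X Y by (simp add: moore_penrose_def)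
  also have "\<dots> = transpose (Y ** A) ** transpose (X ** A)"
    by (metis matrix_transpose_mul matrix_mul_assoc)
  also have "\<dots> = Y ** (A ** X ** A)"
    using X Y unfolding moore_penrose_def by (metis matrix_mul_assoc)
  also have "\<dots> = Y ** A"
    using X by (simp add: moore_penrose_def)
  finally have XA: "X ** A = Y ** A" .
  have "X = X ** A ** X"
    using X by (simp add: moore_penrose_def)
  also have "\<dots> = Y ** (A ** X)"
    by (simp add: XA matrix_mul_assoc)
  also have "\<dots> = Y"
    using Y by (simp add: AX moore_penrose_def matrix_mul_assoc)
  finally show ?thesis .
qed

text \<open>
  With projections \<open>A G\<close> onto the column space and \<open>H A\<close> onto the row space, \<open>H A G\<close> is the
  pseudoinverse; \<open>H\<close> comes from applying the previous construction to \<open>A\<^sup>T\<close>.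
\<close>

lemma moore_penrose_exists:
  fixes A :: "real^'m^'n"
  shows "\<exists>X. moore_penrose A X"
proof -
  obtain G where G: "A ** G ** A = A" "transpose (A ** G) = A ** G"
    using range_projection_exists by blast
  obtain K where K: "transpose A ** K ** transpose A = transpose A"
      "transpose (transpose A ** K) = transpose A ** K"
    using range_projection_exists by blast
  define H where "H = transpose K"
  have H: "A ** H ** A = A" "transpose (H ** A) = H ** A"
    using K unfolding H_def
    by (metis matrix_transpose_mul transpose_transpose matrix_mul_assoc)
      (metis K(2) matrix_transpose_mul transpose_transpose)
  have 1: "A ** (H ** A ** G) = A ** G" and 2: "(H ** A ** G) ** A = H ** A"
    using G(1) H(1) by (metis matrix_mul_assoc)+
  have "(H ** A ** G) ** A ** (H ** A ** G) = H ** A ** G"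
    using H(1) 2 by (metis matrix_mul_assoc)
  with 1 2 G H have "moore_penrose A (H ** A ** G)"
    by (simp add: moore_penrose_def)
  then show ?thesis ..
qed

lemma pinv_eqI: "moore_penrose A X \<Longrightarrow> pinv A = X"
  unfolding pinv_def by (blast intro: moore_penrose_unique)

lemma moore_penrose_pinv: "moore_penrose A (pinv A)"
  using moore_penrose_exists pinv_eqI by metis

lemma pinv_scaleR:
  fixes A :: "real^'m^'n"
  assumes "c \<noteq> 0"
  shows "pinv (c *\<^sub>R A) = (1 / c) *\<^sub>R pinv A"
  by (rule pinv_eqI) (use moore_penrose_pinv[of A] assms in
    \<open>simp add: moore_penrose_def transpose_scalar matrix_scalar_ac flip: scalar_matrix_assoc\<close>)

section \<open>Operator norm and Euclidean norm\<close>

lemma norm_matrix_vector_le: "norm (A *v v) \<le> op_norm A * norm v"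
  unfolding op_norm_def by (rule onorm) simp

lemma op_norm_nonneg: "0 \<le> op_norm A"
  unfolding op_norm_def by (rule onorm_pos_le) simp

lemma op_norm_scaleR: "op_norm (c *\<^sub>R A) = \<bar>c\<bar> * op_norm A"
  using onorm_scaleR[of "(*v) A" c] by (simp add: op_norm_def scaleR_matrix_vector_assoc)

lemma norm_le_sqrt_card:
  fixes v :: "real^'m"
  assumes "\<And>i. \<bar>v $ i\<bar> \<le> b"
  shows "norm v \<le> sqrt CARD('m) * b"
proof -
  have b: "0 \<le> b"
    using assms[of undefined] by linarith
  have "(\<Sum>i\<in>UNIV. (v $ i)\<^sup>2) \<le> (\<Sum>i\<in>(UNIV :: 'm set). b\<^sup>2)"
    by (intro sum_mono) (metis assms b abs_le_square_iff abs_of_nonneg)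
  then have "norm v \<le> sqrt (CARD('m) * b\<^sup>2)"
    by (simp add: norm_vec_def L2_set_def)
  also have "\<dots> = sqrt CARD('m) * b"
    using b by (simp add: real_sqrt_mult)
  finally show ?thesis .
qed

section \<open>Gradients and restriction to a subspace\<close>

lemma gradient_eqI: "GDERIV h y :> g \<Longrightarrow> gradient h y = g"
  unfolding gradient_def
proof (rule the_equality)
  fix g' assume "GDERIV h y :> g" "GDERIV h y :> g'"
  then have "(\<lambda>v. inner v g) = (\<lambda>v. inner v g')"
    unfolding gderiv_def by (rule has_derivative_unique)
  then show "g' = g"
    by (metis vector_eq_ldot)
qed

lemma GDERIV_gradient:
  fixes h :: "real^'n \<Rightarrow> real"
  assumes "h differentiable (at y)"
  shows "GDERIV h y :> gradient h y"
proof -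
  obtain D where D: "(h has_derivative D) (at y)"
    using assms unfolding differentiable_def by blast
  then have "linear D"
    by (rule has_derivative_linear)
  then have "D v = inner v (adjoint D 1)" for v
    using adjoint_works[of D v 1] by (simp add: inner_commute)
  then have "D = (\<lambda>v. inner v (adjoint D 1))" ..
  with D have "GDERIV h y :> adjoint D 1"
    unfolding gderiv_def by metis
  then show ?thesis
    using gradient_eqI by metis
qed

lemma GDERIV_prod_gradient:
  fixes f :: "'i \<Rightarrow> real^'n \<Rightarrow> real"
  assumes "\<And>i. i \<in> I \<Longrightarrow> f i differentiable (at y)"
  shows "GDERIV (\<lambda>y. \<Prod>i\<in>I. f i y) y :> (\<Sum>i\<in>I. (\<Prod>j\<in>I - {i}. f j y) *\<^sub>R gradient (f i) y)"
proof -
  have "((\<lambda>y. \<Prod>i\<in>I. f i y) has_derivative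
      (\<lambda>v. \<Sum>i\<in>I. inner v (gradient (f i) y) * (\<Prod>j\<in>I - {i}. f j y))) (at y)"
    using GDERIV_gradient[OF assms] unfolding gderiv_def by (intro has_derivative_prod)
  then show ?thesis
    by (simp add: gderiv_def inner_sum_right mult.commute)
qed

text \<open>
  \<open>P = (S\<^sup>T)\<^sup>\<dagger> S\<^sup>T\<close> is symmetric, so its values are of the form \<open>S w\<close> and lie in the span of the columns;
  and \<open>S\<^sup>T (v - P v) = 0\<close> says that the remainder is orthogonal to each column.
\<close>

lemma orth_Proj_span_columns:
  fixes S :: "real^'m^'n"
  shows "orth_Proj (span (columns S)) v = (pinv (transpose S) ** transpose S) *v v"
proof -
  define A where "A = transpose S"
  define P where "P = pinv A ** A"
  have mp: "A ** P = A" "transpose P = P"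
    using moore_penrose_pinv[of A] by (simp_all add: P_def moore_penrose_def matrix_mul_assoc)
  have "P = S ** transpose (pinv A)"
    using mp(2) by (metis A_def P_def matrix_transpose_mul transpose_transpose)
  then have in_span: "P *v v \<in> span (columns S)"
    by (metis matrix_vector_mul_assoc matrix_vector_mult_in_columnspace)
  have "A *v (v - P *v v) = 0"
    by (simp add: matrix_vector_mult_diff_distrib matrix_vector_mul_assoc mp)
  then have "inner (column i S) (v - P *v v) = 0" for i
    by (simp add: A_def vec_eq_iff matrix_vector_mul_component transpose_def column_def)
  then have "orthogonal (v - P *v v) c" if "c \<in> columns S" for c
    using that by (auto simp: columns_def orthogonal_def inner_commute)
  then have orth: "orthogonal (v - P *v v) u" if "u \<in> span (columns S)" for u
    using that orthogonal_to_span by blast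
  have "orth_Proj (span (columns S)) v = P *v v"
    unfolding orth_Proj_def
  proof (rule the_equality)
    fix p assume p: "p \<in> span (columns S) \<and> (\<forall>u\<in>span (columns S). orthogonal (v - p) u)"
    have "p - P *v v \<in> span (columns S)"
      using p in_span by (simp add: span_diff)
    with p orth have "inner (v - P *v v) (p - P *v v) = 0" "inner (v - p) (p - P *v v) = 0"
      unfolding orthogonal_def by blast+
    then have "inner (p - P *v v) (p - P *v v) = 0"
      by (simp add: inner_diff_left)
    then show "p = P *v v"
      by simp
  qed (use in_span orth in blast)
  then show ?thesis
    by (simp add: P_def A_def)
qed

lemma gradient_restrict_along:
  fixes S :: "real^'m^'n"
  assumes "GDERIV h x0 :> g"
  shows "gradient (restrict_along (span (columns S)) x0 h) x0
    = (pinv (transpose S) ** transpose S) *v g"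
proof (rule gradient_eqI)
  define P where "P = pinv (transpose S) ** transpose S"
  have symmetric: "transpose P = P"
    using moore_penrose_pinv[of "transpose S"] by (simp add: P_def moore_penrose_def)
  have inner_map: "((\<lambda>y. x0 + P *v (y - x0)) has_derivative (\<lambda>v. P *v v)) (at x0)"
    by (auto intro!: derivative_eq_intros
        bounded_linear.has_derivative[OF matrix_vector_mul_bounded_linear])
  have "(h has_derivative (\<lambda>v. inner v g)) (at (x0 + P *v (x0 - x0)))"
    using assms by (simp add: gderiv_def)
  from has_derivative_compose[OF inner_map this]
  have "((\<lambda>y. h (x0 + P *v (y - x0))) has_derivative (\<lambda>v. inner (P *v v) g)) (at x0)" .
  moreover have "inner (P *v v) g = inner v (P *v g)" for v
    by (metis symmetric dot_lmul_matrix vector_transpose_matrix)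
  ultimately show "GDERIV (restrict_along (span (columns S)) x0 h) x0
      :> (pinv (transpose S) ** transpose S) *v g"
    unfolding restrict_along_def orth_Proj_span_columns P_def[symmetric] gderiv_def by simp
qed

lemma C_k_on_Suc_Suc_differentiable:
  fixes h :: "real^'n \<Rightarrow> real"
  assumes "C_k_on (Suc (Suc k)) h W" "y \<in> W"
  shows "h differentiable (at y)" "gradient h differentiable (at y)"
  using assms
  by (auto simp: differentiable_componentwise_within[of "gradient h"] Basis_vec_def inner_axis)

section \<open>The error of a central difference\<close>

lemma line_derivative:
  fixes h :: "real^'n \<Rightarrow> real"
  assumes "h differentiable (at (x0 + t *\<^sub>R d))"
  shows "((\<lambda>t. h (x0 + t *\<^sub>R d)) has_real_derivative inner (gradient h (x0 + t *\<^sub>R d)) d) (at t)"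
proof -
  have "((\<lambda>t. x0 + t *\<^sub>R d) has_derivative (\<lambda>s. s *\<^sub>R d)) (at t)"
    by (auto intro!: derivative_eq_intros)
  from has_derivative_compose[OF this GDERIV_gradient[OF assms, unfolded gderiv_def]]
  show ?thesis
    by (simp add: has_field_derivative_def inner_commute mult_commute_abs)
qed

lemma gradient_line_derivative:
  fixes h :: "real^'n \<Rightarrow> real"
  assumes "gradient h differentiable (at (x0 + t *\<^sub>R d))"
  shows "((\<lambda>t. inner (gradient h (x0 + t *\<^sub>R d)) e) has_real_derivative
    inner (hessian h (x0 + t *\<^sub>R d) *v d) e) (at t)"
proof -
  have "((\<lambda>t. x0 + t *\<^sub>R d) has_derivative (\<lambda>s. s *\<^sub>R d)) (at t)"
    by (auto intro!: derivative_eq_intros)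
  moreover have "(gradient h has_derivative (*v) (hessian h (x0 + t *\<^sub>R d))) (at (x0 + t *\<^sub>R d))"
    using assms unfolding hessian_def by (simp add: jacobian_works)
  ultimately have "((\<lambda>t. gradient h (x0 + t *\<^sub>R d)) has_derivative
      (\<lambda>s. hessian h (x0 + t *\<^sub>R d) *v (s *\<^sub>R d))) (at t)"
    by (rule has_derivative_compose)
  from has_derivative_inner_left[OF this, of e] show ?thesis
    by (simp add: has_field_derivative_def matrix_vector_mult_scaleR mult_commute_abs)
qed

lemma abs_le_by_power_derivative_bound:
  fixes \<phi> \<phi>' :: "real \<Rightarrow> real"
  assumes deriv: "\<And>s. 0 \<le> s \<Longrightarrow> s \<le> t \<Longrightarrow> (\<phi> has_real_derivative \<phi>' s) (at s)"
    and bound: "\<And>s. 0 \<le> s \<Longrightarrow> s \<le> t \<Longrightarrow> \<bar>\<phi>' s\<bar> \<le> c * s ^ n"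
    and "\<phi> 0 = 0" "0 \<le> t"
  shows "\<bar>\<phi> t\<bar> \<le> c / Suc n * t ^ Suc n"
proof (cases "t = 0")
  case False
  define \<psi> where "\<psi> s = c / Suc n * s ^ Suc n" for s :: real
  have \<psi>: "(\<psi> has_real_derivative c * s ^ n) (at s)" for s
    unfolding \<psi>_def by (auto intro!: derivative_eq_intros simp del: power_Suc of_nat_Suc)
  have "norm (\<phi> t - \<phi> 0) \<le> \<psi> t - \<psi> 0"
  proof (rule differentiable_bound_general)
    show "continuous_on {0..t} \<phi>"
      by (rule DERIV_continuous_on, rule has_field_derivative_at_within) (auto intro: deriv)
    show "continuous_on {0..t} \<psi>"
      by (rule DERIV_continuous_on, rule has_field_derivative_at_within, rule \<psi>)
    show "0 < t"
      using False \<open>0 \<le> t\<close> by simp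
  qed (auto intro: deriv \<psi> bound simp flip: has_real_derivative_iff_has_vector_derivative)
  with \<open>\<phi> 0 = 0\<close> show ?thesis
    by (simp add: \<psi>_def)
qed (use \<open>\<phi> 0 = 0\<close> in simp)

text \<open>
  Along the segment, the error \<open>\<phi>\<close> of the central difference with step \<open>t d\<close> vanishes at \<open>0\<close> together
  with its derivative, and its second derivative is half the change of the Hessian form in direction
  \<open>d\<close> between two points at distance \<open>2 t \<parallel>d\<parallel>\<close>, hence at most \<open>L \<parallel>d\<parallel>\<^sup>3 t\<close>. Integrating this bound twice
  gives the constant \<open>1/6\<close>.
\<close>

lemma centred_difference_error:
  fixes h :: "real^'n \<Rightarrow> real"
  assumes diff: "\<And>y. y \<in> ball x0 r \<Longrightarrow> h differentiable (at y)"
    and grad_diff: "\<And>y. y \<in> ball x0 r \<Longrightarrow> gradient h differentiable (at y)"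
    and lipschitz: "\<And>y z. y \<in> ball x0 r \<Longrightarrow> z \<in> ball x0 r \<Longrightarrow>
      op_norm (hessian h y - hessian h z) \<le> L * norm (y - z)"
    and "norm d < r"
  shows "\<bar>1/2 * (h (x0 + d) - h (x0 - d)) - inner (gradient h x0) d\<bar> \<le> L / 6 * norm d ^ 3"
proof -
  have in_ball: "x0 + t *\<^sub>R d \<in> ball x0 r" "x0 + t *\<^sub>R (- d) \<in> ball x0 r" if "0 \<le> t" "t \<le> 1" for t
  proof -
    have "t * norm d \<le> norm d"
      using that by (simp add: mult_left_le_one_le)
    then show "x0 + t *\<^sub>R d \<in> ball x0 r" "x0 + t *\<^sub>R (- d) \<in> ball x0 r"
      using that \<open>norm d < r\<close> by (simp_all add: dist_norm)
  qed
  define \<phi> where "\<phi> t = 1/2 * (h (x0 + t *\<^sub>R d) - h (x0 + t *\<^sub>R (- d)))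
      - t * inner (gradient h x0) d" for t
  define \<phi>' where "\<phi>' t = 1/2 * (inner (gradient h (x0 + t *\<^sub>R d)) d
      - inner (gradient h (x0 + t *\<^sub>R (- d))) (- d)) - inner (gradient h x0) d" for t
  define \<phi>'' where "\<phi>'' t = 1/2 * (inner (hessian h (x0 + t *\<^sub>R d) *v d) d
      - inner (hessian h (x0 + t *\<^sub>R (- d)) *v (- d)) (- d))" for t
  have \<phi>: "(\<phi> has_real_derivative \<phi>' t) (at t)" if "0 \<le> t" "t \<le> 1" for t
    unfolding \<phi>_def \<phi>'_def
    by (rule derivative_eq_intros line_derivative diff in_ball that refl | simp)+
  have \<phi>': "(\<phi>' has_real_derivative \<phi>'' t) (at t)" if "0 \<le> t" "t \<le> 1" for t
    unfolding \<phi>'_def \<phi>''_def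
    by (rule derivative_eq_intros gradient_line_derivative grad_diff in_ball that refl | simp)+
  have second: "\<bar>\<phi>'' t\<bar> \<le> L * norm d ^ 3 * t ^ 1" if t: "0 \<le> t" "t \<le> 1" for t
  proof -
    define H where "H = hessian h (x0 + t *\<^sub>R d) - hessian h (x0 + t *\<^sub>R (- d))"
    have "x0 + t *\<^sub>R d - (x0 + t *\<^sub>R (- d)) = (2 * t) *\<^sub>R d"
      by (simp add: scaleR_2 flip: scaleR_scaleR)
    then have "op_norm H \<le> L * (2 * t * norm d)"
      using lipschitz[OF in_ball[OF t]] t unfolding H_def by simp
    then have "norm (H *v d) * norm d \<le> L * (2 * t * norm d) * norm d * norm d"
      by (intro mult_right_mono order_trans[OF norm_matrix_vector_le]) auto
    moreover have "\<phi>'' t = 1/2 * inner (H *v d) d"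
      by (simp add: \<phi>''_def H_def matrix_vector_mult_diff_rdistrib inner_diff_left
          linear_neg[OF matrix_vector_mul_linear])
    ultimately show ?thesis
      using Cauchy_Schwarz_ineq2[of "H *v d" d] by (simp add: power3_eq_cube algebra_simps)
  qed
  have first: "\<bar>\<phi>' t\<bar> \<le> L * norm d ^ 3 / 2 * t ^ 2" if "0 \<le> t" "t \<le> 1" for t
    using abs_le_by_power_derivative_bound[of t \<phi>' \<phi>'' "L * norm d ^ 3" 1] \<phi>' second that
    by (simp add: \<phi>'_def numeral_2_eq_2)
  have "\<bar>\<phi> 1\<bar> \<le> L * norm d ^ 3 / 2 / Suc 2 * 1 ^ Suc 2"
    by (rule abs_le_by_power_derivative_bound[of 1 \<phi> \<phi>']) (use \<phi> first in \<open>auto simp: \<phi>_def\<close>)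
  then show ?thesis
    by (simp add: \<phi>_def)
qed

section \<open>The error bound\<close>

lemma simplex_radius_ge: "norm (simplex_dir x0 x i) \<le> simplex_radius x0 x"
  unfolding simplex_radius_def by simp

lemma transpose_simplex_mat_nth:
  "(transpose (simplex_mat x0 x) *v g) $ i = inner g (simplex_dir x0 x i)"
  by (simp add: matrix_vector_mul_component transpose_def simplex_mat_def inner_vec_def mult.commute)

lemma norm_centred_diff_error:
  fixes h :: "real^'n \<Rightarrow> real" and x :: "'m::finite \<Rightarrow> real^'n"
  assumes diff: "\<And>y. y \<in> ball x0 r \<Longrightarrow> h differentiable (at y)"
    and grad_diff: "\<And>y. y \<in> ball x0 r \<Longrightarrow> gradient h differentiable (at y)"
    and lipschitz: "\<And>y z. y \<in> ball x0 r \<Longrightarrow> z \<in> ball x0 r \<Longrightarrow>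
      op_norm (hessian h y - hessian h z) \<le> L * norm (y - z)"
    and radius: "simplex_radius x0 x < r"
    and "x0 \<notin> range x"
  shows "norm (centred_diff h x0 x - transpose (simplex_mat x0 x) *v gradient h x0)
    \<le> sqrt CARD('m) * (L / 6 * simplex_radius x0 x ^ 3)"
proof (rule norm_le_sqrt_card)
  fix i
  let ?d = "simplex_dir x0 x i"
  have "norm ?d < r"
    using simplex_radius_ge[of x0 x i] radius by linarith
  then have error: "\<bar>1/2 * (h (x0 + ?d) - h (x0 - ?d)) - inner (gradient h x0) ?d\<bar>
      \<le> L / 6 * norm ?d ^ 3"
    using centred_difference_error[of x0 r h L ?d] diff grad_diff lipschitz by blast
  \<comment> \<open>The error bound itself shows \<open>L \<ge> 0\<close>, as \<open>d \<noteq> 0\<close>; this allows enlarging \<open>\<parallel>d\<parallel>\<close> to the radius.\<close>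
  have "0 < norm ?d ^ 3"
    using \<open>x0 \<notin> range x\<close> by (auto simp: simplex_dir_def)
  moreover have "0 \<le> L / 6 * norm ?d ^ 3"
    using error by linarith
  ultimately have "0 \<le> L / 6"
    by (metis mult_neg_pos not_le)
  then have "L / 6 * norm ?d ^ 3 \<le> L / 6 * simplex_radius x0 x ^ 3"
    by (intro mult_left_mono power_mono simplex_radius_ge) auto
  with error show "\<bar>(centred_diff h x0 x - transpose (simplex_mat x0 x) *v gradient h x0) $ i\<bar>
      \<le> L / 6 * simplex_radius x0 x ^ 3"
    by (simp add: centred_diff_def transpose_simplex_mat_nth del: transpose_matrix_vector)
qed

theorem proposition5p3:
  fixes k :: nat
    and f :: "nat \<Rightarrow> real^'n \<Rightarrow> real"
    and L :: "nat \<Rightarrow> real"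
    and x0 :: "real^'n"
    and x :: "'m::finite \<Rightarrow> real^'n"
    and \<Delta> \<Delta>bar :: real
    and S Shat :: "real^'m^'n"
    and U :: "(real^'n) set"
  assumes "k \<ge> 2"
    and "\<And>i. i \<in> {1..k} \<Longrightarrow> C_k_on 3 (f i) (ball x0 \<Delta>bar)"
    and "\<And>i y z. i \<in> {1..k} \<Longrightarrow> y \<in> ball x0 \<Delta>bar \<Longrightarrow> z \<in> ball x0 \<Delta>bar \<Longrightarrow>
           op_norm (hessian (f i) y - hessian (f i) z) \<le> L i * norm (y - z)"
    and "inj x" and "x0 \<notin> range x"
    and "\<Delta> = simplex_radius x0 x" and "\<Delta> < \<Delta>bar"
    and "S = simplex_mat x0 x"
    and "rank S = min CARD('m) CARD('n)"
    and "U = span (columns S)"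
    and "Shat = (1 / \<Delta>) *\<^sub>R S"
  shows "norm (centred_calculus_grad k f x0 x
               - gradient (restrict_along U x0 (\<lambda>y. \<Prod>i\<in>{1..k}. f i y)) x0)
         \<le> sqrt CARD('m) / 6 * (\<Sum>i\<in>{1..k}. L i * (\<Prod>j\<in>{1..k} - {i}. \<bar>f j x0\<bar>))
             * op_norm (pinv (transpose Shat)) * \<Delta>\<^sup>2"
proof -
  define A where "A = transpose S"
  define c where "c i = (\<Prod>j\<in>{1..k} - {i}. f j x0)" for i
  define e where "e i = centred_diff (f i) x0 x - A *v gradient (f i) x0" for i
  have "0 < norm (simplex_dir x0 x undefined)"
    using \<open>x0 \<notin> range x\<close> by (auto simp: simplex_dir_def)
  then have \<Delta>: "0 < \<Delta>"
    using simplex_radius_ge[of x0 x undefined] \<open>\<Delta> = simplex_radius x0 x\<close> by linarith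
  have f_diff: "f i differentiable (at y)" "gradient (f i) differentiable (at y)"
    if "i \<in> {1..k}" "y \<in> ball x0 \<Delta>bar" for i y
    using C_k_on_Suc_Suc_differentiable[of 1 "f i"] assms(2)[OF that(1)] that(2)
    by (simp_all only: numeral_3_eq_3 One_nat_def)
  have centre: "x0 \<in> ball x0 \<Delta>bar"
    using \<Delta> \<open>\<Delta> < \<Delta>bar\<close> by simp

  have "GDERIV (\<lambda>y. \<Prod>i\<in>{1..k}. f i y) x0 :> (\<Sum>i\<in>{1..k}. c i *\<^sub>R gradient (f i) x0)"
    unfolding c_def using f_diff(1) centre by (intro GDERIV_prod_gradient)
  then have "gradient (restrict_along U x0 (\<lambda>y. \<Prod>i\<in>{1..k}. f i y)) x0
      = (pinv A ** A) *v (\<Sum>i\<in>{1..k}. c i *\<^sub>R gradient (f i) x0)"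
    unfolding A_def \<open>U = span (columns S)\<close> by (rule gradient_restrict_along)
  then have "centred_calculus_grad k f x0 x
      - gradient (restrict_along U x0 (\<lambda>y. \<Prod>i\<in>{1..k}. f i y)) x0
      = (\<Sum>i\<in>{1..k}. c i *\<^sub>R (pinv A *v e i))"
    by (simp add: centred_calculus_grad_def centred_simplex_grad_def e_def c_def A_def assms(8)
        linear_sum[OF matrix_vector_mul_linear] matrix_vector_mult_scaleR
        matrix_vector_mult_diff_distrib matrix_vector_mul_assoc scaleR_diff_right sum_subtractf
        del: transpose_matrix_vector)
  also have "norm \<dots> \<le> (\<Sum>i\<in>{1..k}. \<bar>c i\<bar> * (op_norm (pinv A) * (sqrt CARD('m) * (L i / 6 * \<Delta> ^ 3))))"
  proof (rule sum_norm_le)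
    fix i assume i: "i \<in> {1..k}"
    have "norm (e i) \<le> sqrt CARD('m) * (L i / 6 * \<Delta> ^ 3)"
      unfolding e_def A_def \<open>S = _\<close> \<open>\<Delta> = _\<close>
      using norm_centred_diff_error[of x0 \<Delta>bar "f i" "L i" x] f_diff i assms(3) assms(5-7) by blast
    then have "norm (pinv A *v e i) \<le> op_norm (pinv A) * (sqrt CARD('m) * (L i / 6 * \<Delta> ^ 3))"
      by (intro order_trans[OF norm_matrix_vector_le] mult_left_mono op_norm_nonneg)
    then show "norm (c i *\<^sub>R (pinv A *v e i))
        \<le> \<bar>c i\<bar> * (op_norm (pinv A) * (sqrt CARD('m) * (L i / 6 * \<Delta> ^ 3)))"
      unfolding norm_scaleR by (rule mult_left_mono) simp
  qed
  also have "op_norm (pinv A) = op_norm (pinv (transpose Shat)) / \<Delta>"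
    using \<Delta> by (simp add: A_def \<open>Shat = _\<close> transpose_scalar pinv_scaleR op_norm_scaleR)
  also have "(\<Sum>i\<in>{1..k}. \<bar>c i\<bar> * (op_norm (pinv (transpose Shat)) / \<Delta>
        * (sqrt CARD('m) * (L i / 6 * \<Delta> ^ 3))))
      = sqrt CARD('m) / 6 * (\<Sum>i\<in>{1..k}. L i * (\<Prod>j\<in>{1..k} - {i}. \<bar>f j x0\<bar>))
          * op_norm (pinv (transpose Shat)) * \<Delta>\<^sup>2"
    using \<Delta> by (simp add: c_def abs_prod sum_distrib_left sum_distrib_right power3_eq_cube
        power2_eq_square mult_ac)
  finally show ?thesis .
qed

end
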